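(* Let $X$ be an alphabet and let $f\in\mathbb{R}^{X^*}$ be a word function, i.e. $f:X^*\to\mathbb{R}$. The derivative automaton $\mathcal{A}_f$ of $f$ is a linear weighted automaton over the vector space $\mathbb{R}^{X^*}$ that computes $f$ and generates the prefix closure $\overline{f}$ of $f$; that is, $\mathcal{A}_f$ is linear, and $[\![\mathcal{A}_f]\!](u)=f(u)$ and $[\![\mathcal{A}_f]\!]_g(u)=\overline{f}(u)$ for every $u\in X^*$. In addition, $\mathcal{A}_f$ is a minimal weighted automaton over a vector space which computes $f$; that is, for every weighted automaton $\mathcal{A}=(S,\sigma,\delta,\Theta)$ over a real vector space (with alphabet $X$) such that $[\![\mathcal{A}]\!]=f$, the cardinality of the set of vector states of $\mathcal{A}_f$ is less than or equal to the cardinality of $S$.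
   Context: $X^*$ denotes the set of all words over $X$, with empty word $\varepsilon$. $\mathbb{R}^{X^*}$ is the real vector space of all functions $X^*\to\mathbb{R}$ with pointwise operations. The norm used on the function space $\mathbb{R}^{X^*}$ is the supremum norm (uniform norm), given by $\|g\|_\infty=\sup_{w\in X^*}|g(w)|$ for every $g:X^*\to\mathbb{R}$. A weighted automaton over a real vector space $V$ is a tuple $\mathcal{A}=(S,\sigma,\delta,\Theta)$, where $S\subseteq V$ is a non-empty (possibly infinite) set of vectors, called the set of vector states, $\sigma\in S$ is the initial vector state, $\delta:S\times X\to S$ is the transition function, and $\Theta:S\to\mathbb{R}$ is the terminal weights function. Write $\delta_x(\alpha)=\delta(\alpha,x)$, and extend $\delta$ to $\delta^*:S\times X^*\to S$ by $\delta^*(\alpha,\varepsilon)=\alpha$ and $\delta^*(\alpha,ux)=\delta(\delta^*(\alpha,u),x)$ for $\alpha\in S$, $u\in X^*$, $x\in X$. The behavior of $\mathcal{A}$ (the function computed by $\mathcal{A}$) is $[\![\mathcal{A}]\!]:X^*\to\mathbb{R}$, $[\![\mathcal{A}]\!](u)=\Theta(\delta^*(\sigma,u))$. For $V=\mathbb{R}^{X^*}$, the function generated by $\mathcal{A}$ is $[\![\mathcal{A}]\!]_g(u)=\|\delta^*(\sigma,u)\|_\infty$, $u\in X^*$. $\mathcal{A}$ is linear if for every $x\in X$ the function $\delta_x$ is the restriction to $S$ of some linear operator $\delta_x':\mathrm{span}(S)\to\mathrm{span}(S)$, and $\Theta$ is the restriction to $S$ of some linear functional $\Theta':\mathrm{span}(S)\to\mathbb{R}$.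 For $f:X^*\to\mathbb{R}$ and $u\in X^*$, the derivative of $f$ with respect to $u$ is the word function $f_u:X^*\to\mathbb{R}$ given by $f_u(v)=f(uv)$ for every $v\in X^*$. The derivative automaton of $f$ is the weighted automaton $\mathcal{A}_f=(S_f,\sigma^f,\delta^f,\Theta^f)$ over the vector space $\mathbb{R}^{X^*}$ with $S_f=\{f_u\mid u\in X^*\}$, $\sigma^f=f$, and $\delta^f(g,x)=g_x$, $\Theta^f(g)=g(\varepsilon)$ for all $g\in S_f$ and $x\in X$. The prefix closure of $f$ is the word function $\overline{f}:X^*\to\mathbb{R}$ defined by $\overline{f}(u)=\sup_{v\in X^*}|f(uv)|=\|f_u\|_\infty$ for every $u\in X^*$. *)

theory Defs
  imports
    Complex_Main
    "HOL-Library.Function_Algebras"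
    "HOL-Library.Extended_Real"
begin

unbundle cardinal_syntax

text \<open>Words over the alphabet \<open>'x\<close> are lists. \<open>Function_Algebras\<close> supplies the pointwise additive
  structure on functions; only scalar multiplication is missing.\<close>

instantiation "fun" :: (type, real_vector) real_vector
begin

definition scaleR_fun :: "real \<Rightarrow> ('a \<Rightarrow> 'b) \<Rightarrow> 'a \<Rightarrow> 'b"
  where "scaleR_fun c g = (\<lambda>w. c *\<^sub>R g w)"

instance
  by standard (auto simp: scaleR_fun_def fun_eq_iff scaleR_add_right scaleR_add_left)

end

text \<open>The supremum of absolute values may be infinite, as word functions need not be bounded;
  hence the extended reals.\<close>

definition sup_norm :: "('a \<Rightarrow> real) \<Rightarrow> ereal"
  where "sup_norm g = (SUP w. ereal \<bar>g w\<bar>)"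

lemma sup_norm_bounded:
  fixes g :: "'a \<Rightarrow> real"
  assumes "\<And>w. \<bar>g w\<bar> \<le> B"
  shows "sup_norm g = ereal (SUP w. \<bar>g w\<bar>)"
proof -
  have "\<bar>SUP w. ereal \<bar>g w\<bar>\<bar> \<noteq> \<infinity>"
    by (rule ereal_SUP_not_infty[where l = 0 and u = "ereal B"]) (use assms in auto)
  then show ?thesis
    by (simp add: sup_norm_def ereal_SUP)
qed

text \<open>The transition and terminal weight functions are total on the type; their values outside
  \<^term>\<open>states\<close> are irrelevant.\<close>

record ('v, 'x) weighted_automaton =
  states :: "'v set"
  initial :: 'v
  trans :: "'v \<Rightarrow> 'x \<Rightarrow> 'v"
  terminal :: "'v \<Rightarrow> real"

definition is_weighted_automaton :: "('v::real_vector, 'x) weighted_automaton \<Rightarrow> bool"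
  where "is_weighted_automaton A \<longleftrightarrow>
    states A \<noteq> {} \<and> initial A \<in> states A \<and> (\<forall>\<alpha>\<in>states A. \<forall>x. trans A \<alpha> x \<in> states A)"

definition trans_star :: "('v::real_vector, 'x) weighted_automaton \<Rightarrow> 'v \<Rightarrow> 'x list \<Rightarrow> 'v"
  where "trans_star A \<alpha> u = foldl (trans A) \<alpha> u"

lemma trans_star_Nil: "trans_star A \<alpha> [] = \<alpha>"
  and trans_star_snoc: "trans_star A \<alpha> (u @ [x]) = trans A (trans_star A \<alpha> u) x"
  by (simp_all add: trans_star_def)

definition behavior :: "('v::real_vector, 'x) weighted_automaton \<Rightarrow> 'x list \<Rightarrow> real"
  where "behavior A u = terminal A (trans_star A (initial A) u)"

definition generated :: "('x list \<Rightarrow> real, 'x) weighted_automaton \<Rightarrow> 'x list \<Rightarrow> ereal"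
  where "generated A u = sup_norm (trans_star A (initial A) u)"

text \<open>Linearity of a map whose domain is the subspace \<open>U\<close>, given by a function that is total on
  the type.\<close>

definition linear_on_subspace :: "'v::real_vector set \<Rightarrow> ('v \<Rightarrow> 'w::real_vector) \<Rightarrow> bool"
  where "linear_on_subspace U h \<longleftrightarrow>
    (\<forall>a\<in>U. \<forall>b\<in>U. h (a + b) = h a + h b) \<and> (\<forall>c. \<forall>a\<in>U. h (c *\<^sub>R a) = c *\<^sub>R h a)"

definition linear_automaton :: "('v::real_vector, 'x) weighted_automaton \<Rightarrow> bool"
  where "linear_automaton A \<longleftrightarrow>
    (\<forall>x. \<exists>D. D ` span (states A) \<subseteq> span (states A) \<and>
       linear_on_subspace (span (states A)) D \<and>
       (\<forall>\<alpha>\<in>states A. trans A \<alpha> x = D \<alpha>)) \<and>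
    (\<exists>T :: 'v \<Rightarrow> real. linear_on_subspace (span (states A)) T \<and>
       (\<forall>\<alpha>\<in>states A. terminal A \<alpha> = T \<alpha>))"

definition word_derivative :: "('x list \<Rightarrow> real) \<Rightarrow> 'x list \<Rightarrow> 'x list \<Rightarrow> real"
  where "word_derivative f u = (\<lambda>v. f (u @ v))"

definition derivative_automaton ::
    "('x list \<Rightarrow> real) \<Rightarrow> ('x list \<Rightarrow> real, 'x) weighted_automaton"
  where "derivative_automaton f =
    \<lparr>states = range (word_derivative f),
     initial = f,
     trans = (\<lambda>g x. word_derivative g [x]),
     terminal = (\<lambda>g. g [])\<rparr>"

definition prefix_closure :: "('x list \<Rightarrow> real) \<Rightarrow> 'x list \<Rightarrow> ereal"
  where "prefix_closure f u = (SUP v. ereal \<bar>f (u @ v)\<bar>)"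

end

theory Submission
  imports Defs
begin

text \<open>Taking derivatives and evaluating at the empty word are linear on the whole function space.
  For minimality, let a state \<open>\<alpha>\<close> of an automaton computing \<open>f\<close> recognise
  \<open>v \<mapsto> \<Theta>(\<delta>\<^sup>*(\<alpha>, v))\<close>. The state reached by \<open>u\<close> recognises \<open>f\<^sub>u\<close>, so the states
  surject onto a superset of the set of derivatives.\<close>

text \<open>The composition law behind both closure of the derivatives under transitions and the
  computation of runs.\<close>

lemma word_derivative_append: "word_derivative (word_derivative f u) v = word_derivative f (u @ v)"
  by (simp add: word_derivative_def)

lemma linear_word_derivative: "linear (\<lambda>g. word_derivative g u)"
  by (rule linearI) (auto simp: word_derivative_def scaleR_fun_def fun_eq_iff)

text \<open>Lets the witnesses for \<open>linear_automaton\<close> be maps on the whole space, so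
  that only invariance of the span remains to be checked.\<close>

lemma linear_imp_linear_on_subspace:
  assumes "linear h"
  shows "linear_on_subspace U h"
  by (simp add: linear_on_subspace_def linear_add[OF assms] linear_scale[OF assms])

lemma trans_star_append: "trans_star A \<alpha> (u @ v) = trans_star A (trans_star A \<alpha> u) v"
  by (simp add: trans_star_def)

lemma trans_star_in_states:
  assumes "is_weighted_automaton A" "\<alpha> \<in> states A"
  shows "trans_star A \<alpha> u \<in> states A"
  using assms by (induction u rule: rev_induct)
    (auto simp: trans_star_Nil trans_star_snoc is_weighted_automaton_def)

lemma is_weighted_automaton_derivative_automaton: "is_weighted_automaton (derivative_automaton f)"
proof -
  have "f = word_derivative f []"
    by (simp add: word_derivative_def)
  then have "f \<in> range (word_derivative f)"
    by (rule range_eqI)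
  then show ?thesis
    by (auto simp: is_weighted_automaton_def derivative_automaton_def word_derivative_append)
qed

lemma linear_automaton_derivative_automaton: "linear_automaton (derivative_automaton f)"
proof -
  let ?S = "range (word_derivative f)"
  have "(\<lambda>g. word_derivative g [x]) ` span ?S \<subseteq> span ?S" for x
  proof -
    \<comment> \<open>Moving the image inside the span reduces invariance to the generators, where
      the derivative by \<open>u\<close> goes to the one by \<open>u @ [x]\<close>.\<close>
    have "(\<lambda>g. word_derivative g [x]) ` span ?S = span ((\<lambda>g. word_derivative g [x]) ` ?S)"
      by (rule linear_span_image[OF linear_word_derivative, symmetric])
    also have "\<dots> \<subseteq> span ?S"
      by (rule span_mono) (auto simp: word_derivative_append)
    finally show ?thesis .
  qed
  then have "\<exists>D. D ` span ?S \<subseteq> span ?S \<and> linear_on_subspace (span ?S) D \<and>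
      (\<forall>\<alpha>\<in>?S. word_derivative \<alpha> [x] = D \<alpha>)" for x
    by (intro exI[of _ "\<lambda>g. word_derivative g [x]"] conjI ballI refl
        linear_imp_linear_on_subspace linear_word_derivative)
  moreover have "linear (\<lambda>g :: 'a list \<Rightarrow> real. g [])"
    by (rule linearI) (auto simp: scaleR_fun_def)
  then have "\<exists>T. linear_on_subspace (span ?S) T \<and> (\<forall>\<alpha>\<in>?S. \<alpha> [] = (T \<alpha> :: real))"
    by (intro exI[of _ "\<lambda>g. g []"] conjI ballI refl linear_imp_linear_on_subspace)
  ultimately show ?thesis
    by (simp only: linear_automaton_def derivative_automaton_def weighted_automaton.simps) simp
qed

text \<open>Reading one more letter appends it to the word of the derivative. Taking
  \<open>g = f\<close>, the state reached by \<open>u\<close> is the derivative of \<open>f\<close>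
  by \<open>u\<close>, which gives both behavior and generated function.\<close>

lemma trans_star_derivative_automaton:
  "trans_star (derivative_automaton f) g u = word_derivative g u"
proof (induction u rule: rev_induct)
  case Nil
  show ?case
    by (simp add: trans_star_Nil word_derivative_def)
next
  case (snoc x u)
  then show ?case
    by (simp add: trans_star_snoc derivative_automaton_def word_derivative_append)
qed

lemma behavior_derivative_automaton: "behavior (derivative_automaton f) u = f u"
  unfolding behavior_def trans_star_derivative_automaton
  by (simp add: derivative_automaton_def word_derivative_def)

lemma generated_derivative_automaton:
  "generated (derivative_automaton f) u = prefix_closure f u"
  unfolding generated_def trans_star_derivative_automaton
  by (simp add: derivative_automaton_def sup_norm_def prefix_closure_def word_derivative_def)

lemma derivative_automaton_minimal:
  assumes A: "is_weighted_automaton A" and f: "behavior A = f"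
  shows "|states (derivative_automaton f)| \<le>o |states A|"
proof (rule surj_imp_ordLeq)
  \<comment> \<open>Only inclusion is claimed: states of \<open>A\<close> that are not reachable may
    recognise functions other than derivatives of \<open>f\<close>.\<close>
  show "states (derivative_automaton f) \<subseteq> (\<lambda>\<alpha> v. terminal A (trans_star A \<alpha> v)) ` states A"
  proof
    fix g assume "g \<in> states (derivative_automaton f)"
    then obtain u where "g = word_derivative f u"
      by (auto simp: derivative_automaton_def)
    \<comment> \<open>The run of \<open>A\<close> on \<open>u @ v\<close> is split after
      \<open>u\<close>.\<close>
    then have "g = (\<lambda>v. terminal A (trans_star A (trans_star A (initial A) u) v))"
      by (simp add: word_derivative_def behavior_def trans_star_append flip: f)
    moreover have "trans_star A (initial A) u \<in> states A"
      using A by (intro trans_star_in_states) (auto simp: is_weighted_automaton_def)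
    ultimately show "g \<in> (\<lambda>\<alpha> v. terminal A (trans_star A \<alpha> v)) ` states A"
      by blast
  qed
qed

theorem theorem4p5:
  fixes f :: "'x list \<Rightarrow> real"
  shows "is_weighted_automaton (derivative_automaton f) \<and>
    linear_automaton (derivative_automaton f) \<and>
    (\<forall>u. behavior (derivative_automaton f) u = f u) \<and>
    (\<forall>u. generated (derivative_automaton f) u = prefix_closure f u) \<and>
    (\<forall>A :: ('v::real_vector, 'x) weighted_automaton.
       is_weighted_automaton A \<longrightarrow> behavior A = f \<longrightarrow>
       |states (derivative_automaton f)| \<le>o |states A| )"
  by (simp add: is_weighted_automaton_derivative_automaton linear_automaton_derivative_automaton
      behavior_derivative_automaton generated_derivative_automaton derivative_automaton_minimal)

end
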